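(* Let $\alpha >0$, $1> \delta >0$ and let $d$ be a positive integer. Then there is a positive constant $\beta$ depending only on $\alpha, d, \delta$ such that for any finite family $\mathcal{F}$ of $n$ convex sets in $\mathbb{R}^d$ such that the intersection of at least $\alpha \binom{n}{2d}$ of the $2d$-tuples (subfamilies of $\mathcal{F}$ of cardinality $2d$) has diameter greater than or equal to one, there is a subfamily $\mathcal{F}'$ of $\mathcal{F}$ of cardinality at least $\beta n$ such that its intersection has diameter at least $1-\delta$.
   Context: The diameter of a set $X\subset\mathbb{R}^d$ is the supremum of Euclidean distances between two of its points; the empty set does not have diameter at least any positive number. The intersection of a family means the intersection of all its members.
   Formalization: The formal statement additionally assumes n ≥ 2d; for 1 ≤ n < 2d there are no 2d-tuples, the hypothesis is vacuous, and the claim fails (e.g. n = 1 with a single point). *)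

theory Defs
  imports "HOL-Analysis.Analysis"
begin

text \<open>
  The library function \<open>diameter\<close> is real-valued and hence carries no information for unbounded
  sets. The sets in question need not be bounded, so the supremum is taken in the extended reals.
  The empty set gets \<open>-\<infinity>\<close>, so it does not have diameter at least any positive number.
\<close>

definition ediameter :: "'a::metric_space set \<Rightarrow> ereal" where
  "ediameter X = (SUP x\<in>X. SUP y\<in>X. ereal (dist x y))"

end

theory Submission imports Defs begin

text \<open>
  Fix a direction \<open>u\<close>. A convex set contains a segment whose extent along \<open>u\<close> is exactly \<open>\<lambda>\<close> iff
  the convex set \<open>F \<times> F\<close> meets the hyperplane \<open>{(x, y). u \<bullet> (y - x) = \<lambda>}\<close>, which has dimension
  \<open>2d - 1\<close>; so the fractional Helly theorem in that hyperplane applies with exactly \<open>2d\<close>-tuples.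
  Every segment of length close to 1 has extent at least \<open>1 - \<delta>\<close> along some member of a finite net
  of directions, and by the pigeonhole principle one direction serves a positive fraction of the tuples.

  For fractional Helly in dimension \<open>k\<close>, the point of an intersection nearest to the origin is already
  determined by \<open>k\<close> of the sets: apply Helly's theorem to the sets and the open ball up to that point.
  Some \<open>k\<close>-subset is therefore responsible for many \<open>(k+1)\<close>-subsets, all of which then share a point.
\<close>

section \<open>Helly's theorem inside a set of bounded affine dimension\<close>

text \<open>Dropping one set at a time gives, by induction, points \<open>x i\<close> lying in every
  \<open>A j\<close> with \<open>j \<noteq> i\<close>. These are at least \<open>k + 2\<close>
  points of \<open>H\<close>, so they either coincide somewhere or admit a Radon partition.
  Measuring dimension by \<open>H\<close> rather than by the ambient space is what later yields
  tuples of size 2d instead of 2d + 1.\<close>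

lemma helly_affine:
  fixes A :: "'i \<Rightarrow> 'a::euclidean_space set"
  assumes "finite I" and "\<And>i. i \<in> I \<Longrightarrow> convex (A i)" and "\<And>i. i \<in> I \<Longrightarrow> A i \<subseteq> H"
    and dim: "aff_dim H \<le> int k"
    and "\<And>J. J \<subseteq> I \<Longrightarrow> card J \<le> k + 1 \<Longrightarrow> (\<Inter>i\<in>J. A i) \<noteq> {}"
  shows "(\<Inter>i\<in>I. A i) \<noteq> {}"
  using assms(1,2,3,5)
proof (induction "card I" arbitrary: I rule: less_induct)
  case less
  show ?case
  proof (cases "card I \<le> k + 1")
    case True
    then show ?thesis using less.prems(4) by blast
  next
    case False
    have "\<exists>x. \<forall>j\<in>I - {i}. x \<in> A j" if "i \<in> I" for i
    proof -
      have "(\<Inter>j\<in>I - {i}. A j) \<noteq> {}"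
      proof (rule less.hyps)
        show "card (I - {i}) < card I"
          using that less.prems(1) by (meson card_Diff1_less)
        show "(\<Inter>j\<in>J. A j) \<noteq> {}" if "J \<subseteq> I - {i}" "card J \<le> k + 1" for J
          using less.prems(4) that by blast
      qed (use less.prems in auto)
      then show ?thesis by auto
    qed
    then obtain x where x: "\<And>i j. i \<in> I \<Longrightarrow> j \<in> I \<Longrightarrow> j \<noteq> i \<Longrightarrow> x i \<in> A j"
      by (metis Diff_iff singletonD)
    show ?thesis
    proof (cases "inj_on x I")
      case False
      then obtain i j where "i \<in> I" "j \<in> I" "i \<noteq> j" "x i = x j"
        by (auto simp: inj_on_def)
      then have "x i \<in> A l" if "l \<in> I" for l
        using x that by (metis (full_types))
      then show ?thesis by auto
    next
      case inj: True
      have "x ` I \<subseteq> H"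
      proof clarify
        fix i assume i: "i \<in> I"
        have "I \<noteq> {i}" using False by auto
        then obtain j where "j \<in> I" "j \<noteq> i" using i by blast
        then show "x i \<in> H" using x[OF i] less.prems(3) by blast
      qed
      then have "affine_dependent (x ` I)"
        using independent_card_le_aff_dim[of "x ` I" H] dim False card_image[OF inj] by linarith
      then obtain M P where MP: "M \<subseteq> x ` I" "P \<subseteq> x ` I" "M \<inter> P = {}"
        "convex hull M \<inter> convex hull P \<noteq> {}"
        by (rule Radon)
      then obtain z where z: "z \<in> convex hull M" "z \<in> convex hull P" by blast
      have "z \<in> A i" if i: "i \<in> I" for i
      proof -
        \<comment> \<open>The only chosen point that may miss \<open>A i\<close> is
          \<open>x i\<close>, and the disjoint parts \<open>M\<close> and \<open>P\<close> cannot
          both contain it. Hence one of the two hulls, and with it \<open>z\<close>, lies in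
          \<open>A i\<close>.\<close>
        have *: "N \<subseteq> A i" if N: "N \<subseteq> x ` I" "x i \<notin> N" for N
        proof
          fix y assume y: "y \<in> N"
          then obtain j where "j \<in> I" "y = x j" using N(1) by blast
          then show "y \<in> A i" using x[of j i] i N(2) y by auto
        qed
        have "M \<subseteq> A i \<or> P \<subseteq> A i" using * MP by blast
        then show ?thesis
          using z less.prems(2)[OF i] by (metis hull_minimal subsetD)
      qed
      then show ?thesis by auto
    qed
  qed
qed

text \<open>The sets together with the ball have no common point, so some \<open>k + 1\<close> of
  them already have none. The ball is among these, since \<open>p\<close> lies in all the others; at
  most \<open>k\<close> of the \<open>K i\<close> therefore suffice to exclude every point nearer to
  \<open>a\<close>.\<close>

lemma closest_point_basis:
  fixes K :: "'i \<Rightarrow> 'a::euclidean_space set"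
  assumes "finite J" and cvx: "\<And>i. i \<in> J \<Longrightarrow> convex (K i)" and cl: "\<And>i. i \<in> J \<Longrightarrow> closed (K i)"
    and KH: "\<And>i. i \<in> J \<Longrightarrow> K i \<subseteq> H" and H: "affine H" and dim: "aff_dim H \<le> int k" and kJ: "k \<le> card J"
    and ne: "H \<inter> (\<Inter>i\<in>J. K i) \<noteq> {}"
  obtains S where "S \<subseteq> J" "card S = k"
    "closest_point (H \<inter> (\<Inter>i\<in>S. K i)) a = closest_point (H \<inter> (\<Inter>i\<in>J. K i)) a"
proof -
  define p where "p = closest_point (H \<inter> (\<Inter>i\<in>J. K i)) a"
  have clJ: "closed (H \<inter> (\<Inter>i\<in>J. K i))"
    using cl H by (intro closed_Int closed_INT affine_closed) auto
  have p: "p \<in> H" "\<And>i. i \<in> J \<Longrightarrow> p \<in> K i"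
    using closest_point_in_set[OF clJ ne, of a] by (auto simp: p_def)
  have pmin: "dist a p \<le> dist a y" if "y \<in> H" "\<And>i. i \<in> J \<Longrightarrow> y \<in> K i" for y
    using closest_point_exists(2)[OF clJ ne, of a] that by (auto simp: p_def)
  \<comment> \<open>The index \<open>None\<close> stands for the open ball, cut down to
    \<open>H\<close> so that Helly's theorem in \<open>H\<close> covers it too.\<close>
  define A where "A = case_option (H \<inter> ball a (dist a p)) K"
  let ?I = "insert None (Some ` J)"
  have "(\<Inter>i\<in>?I. A i) = {}"
    using pmin by (force simp: A_def)
  moreover have "convex (A i)" if "i \<in> ?I" for i
    using that cvx affine_imp_convex[OF H] by (auto simp: A_def intro!: convex_Int)
  moreover have "A i \<subseteq> H" if "i \<in> ?I" for i
    using that KH by (fastforce simp: A_def)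
  ultimately obtain T where T: "T \<subseteq> ?I" "card T \<le> k + 1" "(\<Inter>i\<in>T. A i) = {}"
    using helly_affine[of ?I A H k] dim \<open>finite J\<close> by blast
  have "None \<in> T"
  proof (rule ccontr)
    assume "None \<notin> T"
    then have "p \<in> (\<Inter>i\<in>T. A i)" using T(1) p by (auto simp: A_def)
    then show False using T(3) by blast
  qed
  define S0 where "S0 = {i. Some i \<in> T}"
  have TS: "T = insert None (Some ` S0)"
    using T(1) \<open>None \<in> T\<close> by (auto simp: S0_def)
  have S0J: "S0 \<subseteq> J" using T(1) by (auto simp: S0_def)
  then have "finite S0" using \<open>finite J\<close> finite_subset by blast
  then have "card S0 \<le> k"
    using T(2) by (simp add: TS card_image)
  \<comment> \<open>Padding to exactly \<open>k\<close> indices is harmless: \<open>p\<close> lies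
    in the added sets as well, and they only shrink the intersection.\<close>
  then obtain S where S: "S0 \<subseteq> S" "S \<subseteq> J" "card S = k"
    using exists_subset_between[OF _ kJ S0J \<open>finite J\<close>] by blast
  let ?C = "H \<inter> (\<Inter>i\<in>S. K i)"
  have "p = closest_point ?C a"
  proof (rule closest_point_unique)
    show "convex ?C"
      using S(2) cvx affine_imp_convex[OF H] by (intro convex_Int convex_INT) auto
    show "closed ?C"
      using S(2) cl H by (intro closed_Int closed_INT affine_closed) auto
    show "p \<in> ?C" using p S(2) by auto
    show "\<forall>z\<in>?C. dist a p \<le> dist a z"
    proof
      fix z assume z: "z \<in> ?C"
      have "z \<notin> (\<Inter>i\<in>T. A i)" using T(3) by blast
      then show "dist a p \<le> dist a z"
        using z S(1) by (force simp: TS A_def)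
    qed
  qed
  then show ?thesis using that S p_def by metis
qed

section \<open>Fractional Helly by counting bases\<close>

text \<open>Each good tuple is charged to a \<open>k\<close>-subset with the same closest point. By
  pigeonhole some \<open>S\<close> receives many tuples, each being \<open>S\<close> plus one index,
  and their common closest point lies in all the sets so indexed.\<close>

lemma fractional_helly_affine:
  fixes A :: "nat \<Rightarrow> 'a::euclidean_space set"
  assumes H: "affine H" and dim: "aff_dim H \<le> int k" and "0 < \<alpha>" and kn: "k + 1 \<le> n"
    and cvx: "\<And>i. i < n \<Longrightarrow> convex (A i)" and AH: "\<And>i. i < n \<Longrightarrow> A i \<subseteq> H"
    and many: "real (card {J. J \<subseteq> {..<n} \<and> card J = k + 1 \<and> (\<Inter>i\<in>J. A i) \<noteq> {}})
      \<ge> \<alpha> * real (n choose (k + 1))"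
  obtains J where "J \<subseteq> {..<n}" "real (card J) \<ge> \<alpha> / real (k + 1) * real n" "(\<Inter>i\<in>J. A i) \<noteq> {}"
proof -
  define G where "G = {J. J \<subseteq> {..<n} \<and> card J = k + 1 \<and> (\<Inter>i\<in>J. A i) \<noteq> {}}"
  have finG: "finite G"
    by (rule finite_subset[of _ "Pow {..<n}"]) (auto simp: G_def)
  have "card G \<le> card {J. J \<subseteq> {..<n} \<and> card J = k + 1}"
    by (rule card_mono) (auto simp: G_def)
  then have "card G \<le> n choose (k + 1)" by (simp add: n_subsets)
  moreover have chpos: "0 < n choose (k + 1)" using kn by simp
  ultimately have "\<alpha> * real (n choose (k + 1)) \<le> 1 * real (n choose (k + 1))"
    using many unfolding G_def by linarith
  \<comment> \<open>This bound lets the \<open>k\<close> indices of \<open>S\<close> make up, at the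
    end, for having \<open>n - k\<close> in place of \<open>n\<close>.\<close>
  then have \<alpha>1: "\<alpha> \<le> 1" using chpos by (simp del: binomial_Suc_Suc)
  have "\<forall>J\<in>G. \<exists>x. x \<in> (\<Inter>i\<in>J. A i)" by (auto simp: G_def)
  then obtain q where q: "\<And>J i. J \<in> G \<Longrightarrow> i \<in> J \<Longrightarrow> q J \<in> A i" by (metis INT_E)
  text \<open>The \<open>A i\<close> need not be closed; they are replaced by polytopes with the same good tuples.\<close>
  define K where "K i = convex hull (q ` {J \<in> G. i \<in> J})" for i
  have KA: "K i \<subseteq> A i" if "i < n" for i
    unfolding K_def using cvx[OF that] q by (intro hull_minimal) auto
  have Kcl: "closed (K i)" for i
    unfolding K_def using finG by (intro compact_imp_closed finite_imp_compact_convex_hull) auto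
  have qK: "q J \<in> K i" if "J \<in> G" "i \<in> J" for J i
    unfolding K_def using that by (intro hull_inc) auto
  \<comment> \<open>The factor \<open>H\<close> matters for \<open>k = 0\<close>: there
    \<open>S\<close> is empty and the intersection over \<open>S\<close> alone would be the whole
    space.\<close>
  let ?c = "\<lambda>S. closest_point (H \<inter> (\<Inter>i\<in>S. K i)) 0"
  have cJ: "H \<inter> (\<Inter>i\<in>J. K i) \<noteq> {}" if J: "J \<in> G" for J
  proof -
    have "J \<noteq> {}" "J \<subseteq> {..<n}" using J by (auto simp: G_def)
    then have "q J \<in> H" using qK[OF J] KA AH by blast
    then show ?thesis using qK[OF J] by blast
  qed
  have "\<exists>S\<subseteq>J. card S = k \<and> ?c S = ?c J" if J: "J \<in> G" for J
  proof -
    have J': "J \<subseteq> {..<n}" "card J = k + 1" using J by (auto simp: G_def)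
    show ?thesis
    proof (rule closest_point_basis[of J K H k 0])
      show "finite J" using J'(1) finite_subset by blast
      show "K i \<subseteq> H" if "i \<in> J" for i using that J'(1) KA AH by blast
    qed (use J' cJ[OF J] Kcl H dim in \<open>auto simp: K_def\<close>)
  qed
  then obtain f where f: "\<And>J. J \<in> G \<Longrightarrow> f J \<subseteq> J" "\<And>J. J \<in> G \<Longrightarrow> card (f J) = k"
    "\<And>J. J \<in> G \<Longrightarrow> ?c (f J) = ?c J" by metis
  define B where "B = {S. S \<subseteq> {..<n} \<and> card S = k}"
  have finB: "finite B" by (rule finite_subset[of _ "Pow {..<n}"]) (auto simp: B_def)
  have cardB: "card B = n choose k" by (simp add: B_def n_subsets)
  then have Bpos: "0 < card B" using kn by simp
  have "J \<subseteq> {..<n}" if "J \<in> G" for J using that by (simp add: G_def)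
  then have "f \<in> G \<rightarrow> B" using f(1,2) by (fastforce simp: B_def)
  moreover have "B \<noteq> {}" using Bpos by auto
  ultimately obtain S where S: "S \<in> B" and fib: "card G \<le> card (f -` {S} \<inter> G) * card B"
    using pigeonhole_card[OF _ finG finB] by blast
  define W where "W = f -` {S} \<inter> G"
  have finW: "finite W" using finG by (simp add: W_def)
  have S': "S \<subseteq> {..<n}" "card S = k" "finite S"
    using S finite_subset by (auto simp: B_def)
  \<comment> \<open>This ratio of binomial coefficients is the source of the factor
    \<open>1 / (k + 1)\<close>: dividing the good tuples among the \<open>k\<close>-subsets leaves
    at least \<alpha>(n - k)/(k + 1) for \<open>S\<close>.\<close>
  have ch: "real (k + 1) * real (n choose (k + 1)) = (real n - real k) * real (n choose k)"
  proof -
    have "(k + 1) * (n choose (k + 1)) = (n - k) * (n choose k)"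
      using binomial_absorption[of k n] binomial_absorb_comp[of n k] by simp
    then have "real ((k + 1) * (n choose (k + 1))) = real ((n - k) * (n choose k))" by (rule arg_cong)
    then show ?thesis using kn by (simp only: of_nat_mult of_nat_diff)
  qed
  have "\<alpha> * (real n - real k) * real (card B) = real (k + 1) * (\<alpha> * real (n choose (k + 1)))"
    by (simp only: mult.assoc mult.left_commute[of _ \<alpha>] ch cardB)
  also have "\<dots> \<le> real (k + 1) * real (card G)"
    using many by (intro mult_left_mono) (auto simp: G_def)
  also have "\<dots> \<le> real (k + 1) * real (card W * card B)"
    using fib by (intro mult_left_mono) (simp_all only: W_def of_nat_le_iff of_nat_0_le_iff)
  finally have "(\<alpha> * (real n - real k)) * real (card B) \<le> (real (k + 1) * real (card W)) * real (card B)"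
    by (simp add: algebra_simps)
  then have Wbig: "\<alpha> * (real n - real k) \<le> real (k + 1) * real (card W)"
    using Bpos by (simp only: mult_le_cancel_right)
  have Wpos: "W \<noteq> {}"
  proof
    assume "W = {}"
    then have "\<alpha> * (real n - real k) \<le> 0" using Wbig by simp
    moreover have "0 < \<alpha> * (real n - real k)" using \<open>0 < \<alpha>\<close> kn by simp
    ultimately show False by simp
  qed
  have W: "J \<in> G" "S \<subseteq> J" "?c J = ?c S" "card J = k + 1" "J \<subseteq> {..<n}" if "J \<in> W" for J
  proof -
    show J: "J \<in> G" using that by (simp add: W_def)
    have "f J = S" using that by (simp add: W_def)
    then show "S \<subseteq> J" "?c J = ?c S" using f(1,3)[OF J] by auto
    show "card J = k + 1" "J \<subseteq> {..<n}" using J by (auto simp: G_def)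
  qed
  define U where "U = \<Union>W"
  have Un: "U \<subseteq> {..<n}" using W(5) by (auto simp: U_def)
  then have finU: "finite U" using finite_subset by blast
  have SU: "S \<subseteq> U" using Wpos W(2) by (auto simp: U_def)
  have "\<exists>j. j \<in> U - S \<and> J = insert j S" if J: "J \<in> W" for J
  proof -
    have "card (J - S) = 1"
      using W(2,4)[OF J] S' by (simp add: card_Diff_subset)
    then obtain j where "J - S = {j}" using card_1_singletonE by blast
    then show ?thesis using W(2)[OF J] J by (auto simp: U_def)
  qed
  then have "W \<subseteq> (\<lambda>j. insert j S) ` (U - S)" by blast
  then have "card W \<le> card (U - S)" using finU by (meson finite_Diff surj_card_le)
  also have "\<dots> = card U - k" using SU S' by (simp add: card_Diff_subset)
  finally have "card W + k \<le> card U"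
    using card_mono[OF finU SU] S'(2) by simp
  then have "real (k + 1) * (real (card W) + real k) \<le> real (k + 1) * real (card U)"
    by (intro mult_left_mono) simp_all
  moreover have "\<alpha> * real k \<le> real (k + 1) * real k"
    using \<alpha>1 by (intro mult_right_mono) simp_all
  ultimately have "\<alpha> * real n \<le> real (k + 1) * real (card U)"
    using Wbig by (simp add: algebra_simps)
  then have "\<alpha> / real (k + 1) * real n \<le> real (card U)"
    by (simp add: field_simps)
  moreover have "?c S \<in> A i" if i: "i \<in> U" for i
  proof -
    obtain J where J: "J \<in> W" "i \<in> J" using i by (auto simp: U_def)
    have "closed (H \<inter> (\<Inter>i\<in>J. K i))"
      using Kcl H by (intro closed_Int closed_INT affine_closed) auto
    then have "?c J \<in> K i"
      using closest_point_in_set[OF _ cJ[OF W(1)[OF J(1)]], of 0] J(2) by blast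
    then show ?thesis using W(3)[OF J(1)] KA[of i] Un i by auto
  qed
  ultimately show ?thesis using that[OF Un] by blast
qed

section \<open>From diameters to finitely many directions\<close>

text \<open>If the unit vector v = w/|w| is within \<epsilon> of \<open>u\<close>, then |w| - u . w
  = (v - u) . w is at most \<epsilon>|w|. Compactness of the sphere makes finitely many
  \<open>u\<close> enough.\<close>

lemma finite_direction_net:
  fixes \<epsilon> :: real
  assumes "0 < \<epsilon>"
  obtains U :: "'a::euclidean_space set" where "finite U" "U \<subseteq> sphere 0 1"
    "\<And>w. w \<noteq> 0 \<Longrightarrow> \<exists>u\<in>U. (1 - \<epsilon>) * norm w \<le> u \<bullet> w"
proof -
  have "compact (sphere 0 1 :: 'a set)" by simp
  then obtain U :: "'a set" where U: "finite U" "U \<subseteq> sphere 0 1" "sphere 0 1 \<subseteq> (\<Union>u\<in>U. ball u \<epsilon>)"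
    using compactE_image[of "sphere 0 1" "sphere 0 1" "\<lambda>u. ball u \<epsilon>"] assms
    by (smt (verit) UN_I centre_in_ball open_ball subsetI)
  moreover have "\<exists>u\<in>U. (1 - \<epsilon>) * norm w \<le> u \<bullet> w" if "w \<noteq> 0" for w
  proof -
    have "w /\<^sub>R norm w \<in> sphere 0 1" using that by simp
    then have "w /\<^sub>R norm w \<in> (\<Union>u\<in>U. ball u \<epsilon>)" using U(3) by (rule subsetD[rotated])
    then obtain u where u: "u \<in> U" "dist u (w /\<^sub>R norm w) < \<epsilon>" by (auto simp only: UN_iff mem_ball)
    have "(w /\<^sub>R norm w - u) \<bullet> w \<le> norm (w /\<^sub>R norm w - u) * norm w"
      by (rule norm_cauchy_schwarz)
    also have "\<dots> \<le> \<epsilon> * norm w"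
      using u(2) by (intro mult_right_mono) (simp_all add: dist_norm norm_minus_commute)
    also have "(w /\<^sub>R norm w - u) \<bullet> w = norm w - u \<bullet> w"
      using that by (simp add: inner_diff_left dot_square_norm power2_eq_square)
    finally show ?thesis using u(1) by (auto simp: algebra_simps)
  qed
  ultimately show ?thesis using that by blast
qed

lemma less_ediameterE:
  assumes "ereal r < ediameter X"
  obtains x y where "x \<in> X" "y \<in> X" "r < dist x y"
  using assms by (auto simp: ediameter_def less_SUP_iff)

lemma dist_le_ediameter:
  assumes "x \<in> X" "y \<in> X"
  shows "ereal (dist x y) \<le> ediameter X"
  unfolding ediameter_def using assms by (meson SUP_upper2 order_refl)

theorem theorem4p1:
  fixes \<alpha> \<delta> :: real
  assumes "\<alpha> > 0" and "0 < \<delta>" and "\<delta> < 1"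
  shows "\<exists>\<beta>::real. \<beta> > 0 \<and>
    (\<forall>(n::nat) (F :: nat \<Rightarrow> (real ^ 'd) set).
       2 * CARD('d) \<le> n \<longrightarrow>
       (\<forall>i<n. convex (F i)) \<longrightarrow>
       real (card {J. J \<subseteq> {..<n} \<and> card J = 2 * CARD('d) \<and> 1 \<le> ediameter (\<Inter>i\<in>J. F i)})
         \<ge> \<alpha> * real (n choose (2 * CARD('d))) \<longrightarrow>
       (\<exists>J. J \<subseteq> {..<n} \<and> real (card J) \<ge> \<beta> * real n \<and>
            ediameter (\<Inter>i\<in>J. F i) \<ge> ereal (1 - \<delta>)))"
proof -
  \<comment> \<open>The loss \<delta> is split in two: half for the supremum in the diameter, which
    need not be attained, and half for the direction. Then (1 - \<delta>/2)^2 is at least 1 -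
    \<delta>.\<close>
  obtain U :: "(real ^ 'd) set" where U: "finite U" "U \<subseteq> sphere 0 1"
    "\<And>w. w \<noteq> 0 \<Longrightarrow> \<exists>u\<in>U. (1 - \<delta>/2) * norm w \<le> u \<bullet> w"
    using finite_direction_net[of "\<delta>/2"] \<open>0 < \<delta>\<close> by (metis half_gt_zero)
  have "\<exists>w :: real ^ 'd. w \<noteq> 0" by (rule exI[of _ 1]) simp
  then have "U \<noteq> {}" using U(3) by blast
  then have cU: "0 < card U" using U(1) by (simp add: card_gt_0_iff)
  define k where "k = 2 * CARD('d) - 1"
  have k1: "k + 1 = 2 * CARD('d)" unfolding k_def using zero_less_card_finite[where 'a='d] by linarith
  \<comment> \<open>Choosing one direction costs the factor \<open>card U\<close>, and fractional
    Helly costs \<open>k + 1\<close>.\<close>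
  define \<beta> where "\<beta> = \<alpha> / real (card U) / real (k + 1)"
  have "\<beta> > 0" using \<open>\<alpha> > 0\<close> cU by (simp add: \<beta>_def)
  moreover have "\<exists>J. J \<subseteq> {..<n} \<and> real (card J) \<ge> \<beta> * real n \<and> ediameter (\<Inter>i\<in>J. F i) \<ge> ereal (1 - \<delta>)"
    if n: "k + 1 \<le> n" and cvx: "\<forall>i<n. convex (F i)"
      and many: "real (card {J. J \<subseteq> {..<n} \<and> card J = k + 1 \<and> 1 \<le> ediameter (\<Inter>i\<in>J. F i)})
         \<ge> \<alpha> * real (n choose (k + 1))" for n and F :: "nat \<Rightarrow> (real ^ 'd) set"
  proof -
    define G where "G = {J. J \<subseteq> {..<n} \<and> card J = k + 1 \<and> 1 \<le> ediameter (\<Inter>i\<in>J. F i)}"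
    have finG: "finite G" by (rule finite_subset[of _ "Pow {..<n}"]) (auto simp: G_def)
    have "\<exists>u\<in>U. \<exists>x y. (\<forall>i\<in>J. x \<in> F i \<and> y \<in> F i) \<and> u \<bullet> (y - x) = 1 - \<delta>" if J: "J \<in> G" for J
    proof -
      have "ereal (1 - \<delta>/2) < 1" using \<open>0 < \<delta>\<close> by simp
      also have "1 \<le> ediameter (\<Inter>i\<in>J. F i)" using J by (simp add: G_def)
      finally obtain x y where xy: "\<And>i. i \<in> J \<Longrightarrow> x \<in> F i" "\<And>i. i \<in> J \<Longrightarrow> y \<in> F i" "1 - \<delta>/2 < dist x y"
        by (elim less_ediameterE) blast
      have w: "1 - \<delta>/2 < norm (y - x)" using xy(3) by (simp add: dist_norm norm_minus_commute)
      then have "y - x \<noteq> 0" using \<open>\<delta> < 1\<close> by auto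
      then obtain u where u: "u \<in> U" "(1 - \<delta>/2) * norm (y - x) \<le> u \<bullet> (y - x)" using U(3) by blast
      have "1 - \<delta> \<le> (1 - \<delta>/2) * (1 - \<delta>/2)" by (simp add: algebra_simps)
      also have "\<dots> \<le> (1 - \<delta>/2) * norm (y - x)"
        using w \<open>\<delta> < 1\<close> by (intro mult_left_mono) auto
      finally have le: "1 - \<delta> \<le> u \<bullet> (y - x)" using u(2) by linarith
      \<comment> \<open>The segment is shortened until its extent along \<open>u\<close> is exactly
        1 - \<delta>, so that all tuples sharing \<open>u\<close> meet one and the same hyperplane
        of pairs.\<close>
      define t where "t = (1 - \<delta>) / (u \<bullet> (y - x))"
      have t: "0 \<le> t" "t \<le> 1" "t * (u \<bullet> (y - x)) = 1 - \<delta>"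
        using le \<open>\<delta> < 1\<close> by (auto simp: t_def)
      define z where "z = (1 - t) *\<^sub>R x + t *\<^sub>R y"
      have "z - x = t *\<^sub>R (y - x)" by (simp add: z_def algebra_simps)
      then have "u \<bullet> (z - x) = 1 - \<delta>" using t(3) by simp
      moreover have "z \<in> F i" if i: "i \<in> J" for i
      proof -
        have "convex (F i)" using i J cvx by (auto simp: G_def)
        then show ?thesis using xy(1,2)[OF i] t by (simp add: z_def convex_alt)
      qed
      ultimately show ?thesis using u(1) xy(1) by blast
    qed
    then obtain g where g: "\<And>J. J \<in> G \<Longrightarrow> g J \<in> U"
      "\<And>J. J \<in> G \<Longrightarrow> \<exists>x y. (\<forall>i\<in>J. x \<in> F i \<and> y \<in> F i) \<and> g J \<bullet> (y - x) = 1 - \<delta>" by metis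
    have "g \<in> G \<rightarrow> U" using g(1) by blast
    then obtain u where u: "u \<in> U" "card G \<le> card (g -` {u} \<inter> G) * card U"
      using pigeonhole_card[OF _ finG U(1) \<open>U \<noteq> {}\<close>] by blast
    define H where "H = {p. (-u, u) \<bullet> p = 1 - \<delta>}"
    have Hiff: "(x, y) \<in> H \<longleftrightarrow> u \<bullet> (y - x) = 1 - \<delta>" for x y
      by (simp add: H_def inner_diff_right)
    have nu: "norm u = 1" using U(2) u(1) by auto
    then have "(-u, u) \<noteq> 0" by (auto simp: zero_prod_def)
    then have dimH: "aff_dim H = int k"
      using k1 by (simp add: H_def)
    define A where "A i = H \<inter> F i \<times> F i" for i
    have "affine H" unfolding H_def by (rule affine_hyperplane)
    let ?W = "{J. J \<subseteq> {..<n} \<and> card J = k + 1 \<and> (\<Inter>i\<in>J. A i) \<noteq> {}}"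
    have "g -` {u} \<inter> G \<subseteq> ?W"
    proof
      fix J assume J: "J \<in> g -` {u} \<inter> G"
      then obtain x y where "\<forall>i\<in>J. x \<in> F i \<and> y \<in> F i" "u \<bullet> (y - x) = 1 - \<delta>"
        using g(2) by blast
      then have "(x, y) \<in> (\<Inter>i\<in>J. A i)" by (auto simp: A_def Hiff)
      then show "J \<in> ?W" using J unfolding G_def by blast
    qed
    moreover have "finite ?W" by (rule finite_subset[of _ "Pow {..<n}"]) auto
    ultimately have "card (g -` {u} \<inter> G) \<le> card ?W" by (rule card_mono[rotated])
    then have "card G \<le> card ?W * card U" using u(2) by (meson le_trans mult_le_mono1)
    then have "real (card G) \<le> real (card ?W) * real (card U)"
      by (simp only: of_nat_le_iff flip: of_nat_mult)
    then have "\<alpha> * real (n choose (k + 1)) \<le> real (card ?W) * real (card U)"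
      using many unfolding G_def by linarith
    then have W: "\<alpha> / real (card U) * real (n choose (k + 1)) \<le> real (card ?W)"
      using cU by (simp add: field_simps del: binomial_Suc_Suc)
    have cvxA: "convex (A i)" if "i < n" for i
      unfolding A_def using cvx that \<open>affine H\<close>
      by (intro convex_Int convex_Times) (auto intro: affine_imp_convex)
    have AH: "A i \<subseteq> H" for i by (auto simp: A_def)
    obtain J where J: "J \<subseteq> {..<n}" "\<beta> * real n \<le> real (card J)" "(\<Inter>i\<in>J. A i) \<noteq> {}"
    proof (rule fractional_helly_affine[OF \<open>affine H\<close> _ _ n cvxA AH W])
      show "aff_dim H \<le> int k" using dimH by simp
      show "0 < \<alpha> / real (card U)" using \<open>\<alpha> > 0\<close> cU by simp
    qed (auto simp only: \<beta>_def)
    \<comment> \<open>A nonempty \<open>J\<close> is essential: only membership in some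
      \<open>A i\<close> puts the pair on \<open>H\<close>, and an empty intersection index would
      allow any pair.\<close>
    have "0 < \<beta> * real n" using \<open>\<beta> > 0\<close> n by simp
    then have "J \<noteq> {}" using J(2) by auto
    moreover obtain x y where "(x, y) \<in> (\<Inter>i\<in>J. A i)" using J(3) by auto
    ultimately have xy: "\<And>i. i \<in> J \<Longrightarrow> x \<in> F i" "\<And>i. i \<in> J \<Longrightarrow> y \<in> F i" "u \<bullet> (y - x) = 1 - \<delta>"
      by (auto simp: A_def Hiff)
    have "1 - \<delta> \<le> norm u * norm (y - x)" using norm_cauchy_schwarz[of u "y - x"] xy(3) by simp
    then have "ereal (1 - \<delta>) \<le> ereal (dist y x)" using nu by (simp add: dist_norm)
    also have "\<dots> \<le> ediameter (\<Inter>i\<in>J. F i)" using xy(1,2) by (intro dist_le_ediameter) auto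
    finally show ?thesis using J by blast
  qed
  ultimately show ?thesis unfolding k1 by blast
qed

end
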